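(* Let $u(n)=\sum_{j=0}^n\binom nj^2\binom{2j}j\binom{2n-2j}{n-j}$ (the Domb numbers). Then in a neighborhood of $x=0$, $$\sum_{n=0}^\infty\binom{2n}{n}\frac{(-x)^n}{(1-16x)^{n+1/2}}\sum_{k=0}^n\binom{2k}k^2\binom{2n-2k}{n-k}x^k=\sum_{n=0}^\infty u(n)x^n.$$
   Context: $(1-16x)^{n+1/2}$ denotes the principal branch (equal to $1$ at $x=0$). *)

theory Defs
  imports "HOL-Analysis.Analysis"
begin

definition domb :: "nat \<Rightarrow> nat" where
  "domb n = (\<Sum>j=0..n. (n choose j)\<^sup>2 * ((2 * j) choose j) * ((2 * n - 2 * j) choose (n - j)))"

end

theory Submission
  imports Defs
begin

text \<open>
  Write \<open>c n\<close> for the central binomial coefficient. The binomial series gives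
  \<open>c n / (1 - 16 x) powr (n + 1/2) = (\<Sum>m. c (n + m) * C (n + m, n) * 4 ^ m * x ^ m)\<close>, so the left-hand
  side becomes a triple series over \<open>n, k, m\<close>, absolutely convergent for \<open>norm x < 1/32\<close>.
  Collect the terms with \<open>n + k + m = M\<close>. For fixed \<open>k\<close>, the sum over \<open>n\<close> is evaluated by
  Vandermonde's identity, which leaves \<open>\<Sum>k. (-1) ^ k * c k * C (M - k, k) * (c (M - k))\<^sup>2\<close> as the
  coefficient of \<open>x ^ M\<close>. This equals the Domb number: the Pfaff--Saalschuetz identity rewrites
  \<open>C (M, j)\<^sup>2 * c j * c (M - j)\<close> as
  \<open>\<Sum>k. (-1) ^ k * C (M, k) * c k * c (M - k) * C (M - k, j) * C (M - k, M - j)\<close>,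
  and the sum over \<open>j\<close> is again a Vandermonde convolution.
\<close>

section \<open>Central binomial coefficients as generalized binomials with half-integer upper
  index\<close>

lemma central_binomial_Suc:
  "Suc n * ((2 * Suc n) choose Suc n) = 2 * (2 * n + 1) * ((2 * n) choose n)"
proof -
  have "Suc n * ((2 * Suc n) choose Suc n) = (2 * n + 2) * ((2 * n + 1) choose n)"
    using binomial_absorption[of n "2 * Suc n"] by simp
  also have "(2 * n + 1) choose n = (2 * n + 1) choose Suc n"
    using binomial_symmetric[of n "2 * n + 1"] by simp
  also have "(2 * n + 2) * \<dots> = 2 * (Suc n * ((2 * n + 1) choose Suc n))"
    by simp
  also have "Suc n * ((2 * n + 1) choose Suc n) = (2 * n + 1) * ((2 * n) choose n)"
    using binomial_absorption[of n "2 * n + 1"] by simp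
  finally show ?thesis by simp
qed

text \<open>Passing from \<open>m\<close> to \<open>m + 1\<close> multiplies both sides by
  \<open>4 * (k + m + 1/2) / (m + 1)\<close>. This is the dictionary between half-integer binomials,
  to which Vandermonde-type identities apply, and products of ordinary binomials.\<close>

lemma central_binomial_gbinomial:
  "of_nat ((2 * k) choose k) * ((of_nat (k + m) - 1 / 2) gchoose m) * 4 ^ m =
   (of_nat (((2 * (k + m)) choose (k + m)) * ((k + m) choose k)) :: 'a :: field_char_0)"
proof (induction m)
  case 0
  show ?case by simp
next
  case (Suc m)
  let ?c = "\<lambda>n. of_nat ((2 * n) choose n) :: 'a"
  let ?N = "k + m"
  have g: "of_nat (Suc m) * ((of_nat (k + Suc m) - 1 / 2) gchoose Suc m) =
      (of_nat ?N + 1 / 2) * ((of_nat ?N - 1 / 2 :: 'a) gchoose m)"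
    using gbinomial_absorption[of m "of_nat ?N + 1 / 2 :: 'a"] by (simp add: algebra_simps)
  have c: "of_nat (Suc ?N) * ?c (Suc ?N) = 2 * (2 * of_nat ?N + 1) * ?c ?N"
    using arg_cong[OF central_binomial_Suc[of ?N], of "of_nat :: _ \<Rightarrow> 'a"]
    by (simp only: of_nat_mult of_nat_add of_nat_numeral of_nat_1)
  have "Suc m * (Suc ?N choose k) = Suc ?N * (?N choose k)"
    using binomial_absorb_comp[of "Suc ?N" k] by simp
  from arg_cong[OF this, of "of_nat :: _ \<Rightarrow> 'a"]
  have b: "of_nat (Suc m) * of_nat (Suc ?N choose k) = (of_nat (Suc ?N) * of_nat (?N choose k) :: 'a)"
    by (simp only: of_nat_mult)
  have "of_nat (Suc m) * (?c k * ((of_nat (k + Suc m) - 1 / 2) gchoose Suc m) * 4 ^ Suc m) =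
      4 * (of_nat ?N + 1 / 2) * (?c k * ((of_nat ?N - 1 / 2) gchoose m) * 4 ^ m)"
  proof -
    have "of_nat (Suc m) * (?c k * ((of_nat (k + Suc m) - 1 / 2) gchoose Suc m) * 4 ^ Suc m) =
        (of_nat (Suc m) * ((of_nat (k + Suc m) - 1 / 2) gchoose Suc m)) * (?c k * 4 ^ Suc m)"
      by (simp only: mult_ac)
    thus ?thesis
      unfolding g by (simp only: power_Suc mult_ac)
  qed
  also have "\<dots> = 2 * (2 * of_nat ?N + 1) * ?c ?N * of_nat (?N choose k)"
    unfolding Suc.IH of_nat_mult by (simp add: algebra_simps)
  also have "\<dots> = of_nat (Suc m) * (?c (Suc ?N) * of_nat (Suc ?N choose k))"
    using b c by algebra
  finally show ?case
    unfolding mult_cancel_left by (simp del: of_nat_Suc)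
qed

text \<open>The case \<open>k = 0\<close> of \<open>central_binomial_gbinomial\<close>, after
  negating the upper index.\<close>

lemma gbinomial_minus_half_eq_central_binomial:
  "(-4) ^ m * ((- (1 / 2)) gchoose m) = (of_nat ((2 * m) choose m) :: 'a :: field_char_0)"
  using central_binomial_gbinomial[of 0 m, where 'a = 'a]
    gbinomial_minus[of "1 / 2 :: 'a" m]
    power_mult_distrib[of "-1 :: 'a" "-4" m]
  by (simp add: add.commute mult_ac)

section \<open>Finite binomial sums and the alternating formula for the Domb numbers\<close>

lemma gbinomial_Vandermonde_atMost:
  "(\<Sum>k\<le>n. (a gchoose k) * (b gchoose (n - k))) = (a + b :: 'a :: field_char_0) gchoose n"
  using gbinomial_Vandermonde[of a b n] by (simp add: atMost_atLeast0)

text \<open>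
  Both sides reduce to \<open>\<Sum>i. C (x, i) * C (l + j, j - i) * C (l + i, i)\<close>: expand the last factor on the
  left by Vandermonde with the splitting \<open>(x - k) + (l + j)\<close>, and \<open>C (x + j, j)\<close> on the right.
\<close>
lemma gbinomial_Saalschuetz:
  fixes x :: "'a :: field_char_0"
  shows "(\<Sum>k\<le>j. (x gchoose k) * of_nat (l choose k) *
           ((x + of_nat l + of_nat (j - k)) gchoose (j - k))) =
         ((x + of_nat j) gchoose j) * of_nat ((l + j) choose j)"
proof -
  have "(\<Sum>k\<le>j. (x gchoose k) * of_nat (l choose k) *
           ((x + of_nat l + of_nat (j - k)) gchoose (j - k))) =
    (\<Sum>k\<le>j. \<Sum>i=k..j. (x gchoose i) * of_nat ((l + j) choose (j - i)) *
        of_nat ((i choose k) * (l choose k)))"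
  proof (intro sum.cong refl)
    fix k assume "k \<in> {..j}"
    hence k: "k \<le> j" by simp
    have "(x + of_nat l + of_nat (j - k)) gchoose (j - k) =
        ((x - of_nat k) + of_nat (l + j)) gchoose (j - k)"
      using k by (simp add: of_nat_diff algebra_simps)
    also have "\<dots> = (\<Sum>m\<le>j - k. ((x - of_nat k) gchoose m) * of_nat ((l + j) choose (j - k - m)))"
      by (subst gbinomial_Vandermonde_atMost[symmetric]) (simp add: binomial_gbinomial)
    also have "\<dots> = (\<Sum>i=k..j. ((x - of_nat k) gchoose (i - k)) * of_nat ((l + j) choose (j - i)))"
      by (rule sum.reindex_bij_witness[of _ "\<lambda>i. i - k" "\<lambda>m. m + k"]) (use k in \<open>auto simp: add.commute\<close>)
    finally have "(x gchoose k) * of_nat (l choose k) *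
           ((x + of_nat l + of_nat (j - k)) gchoose (j - k)) =
      (\<Sum>i=k..j. ((x gchoose k) * ((x - of_nat k) gchoose (i - k))) *
          of_nat ((l + j) choose (j - i)) * of_nat (l choose k))"
      by (simp add: sum_distrib_left mult_ac)
    \<comment> \<open>Trinomial revision confines \<open>k\<close> to the factor
      \<open>(i choose k) * (l choose k)\<close>, so after interchanging the sums the inner one is a
      Vandermonde convolution.\<close>
    also have "\<dots> = (\<Sum>i=k..j. (x gchoose i) * of_nat ((l + j) choose (j - i)) *
        of_nat ((i choose k) * (l choose k)))"
      by (intro sum.cong refl, subst gbinomial_trinomial_revision[symmetric])
         (auto simp: binomial_gbinomial mult_ac)
    finally show "(x gchoose k) * of_nat (l choose k) *
           ((x + of_nat l + of_nat (j - k)) gchoose (j - k)) = \<dots>" .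
  qed
  also have "\<dots> = (\<Sum>i\<le>j. \<Sum>k\<le>i. (x gchoose i) * of_nat ((l + j) choose (j - i)) *
        of_nat ((i choose k) * (l choose k)))"
    unfolding sum.Sigma[OF finite_atMost ballI[OF finite_atLeastAtMost]]
      sum.Sigma[OF finite_atMost ballI[OF finite_atMost]]
    by (rule sum.reindex_bij_witness[of _ "\<lambda>(i, k). (k, i)" "\<lambda>(k, i). (i, k)"]) auto
  also have "\<dots> = (\<Sum>i\<le>j. (x gchoose i) * of_nat ((l + j) choose (j - i)) * of_nat ((l + i) choose i))"
  proof (intro sum.cong refl)
    fix i
    have "(\<Sum>k\<le>i. (i choose k) * (l choose k)) = (\<Sum>k\<le>i. (l choose k) * (i choose (i - k)))"
      by (intro sum.cong refl) (metis atMost_iff binomial_symmetric mult.commute)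
    also have "\<dots> = (l + i) choose i"
      by (rule vandermonde)
    finally show "(\<Sum>k\<le>i. (x gchoose i) * of_nat ((l + j) choose (j - i)) *
        of_nat ((i choose k) * (l choose k))) =
      (x gchoose i) * of_nat ((l + j) choose (j - i)) * of_nat ((l + i) choose i)"
      by (simp only: sum_distrib_left[symmetric] of_nat_sum[symmetric])
  qed
  also have "\<dots> = (\<Sum>i\<le>j. (x gchoose i) * of_nat (j choose (j - i))) * of_nat ((l + j) choose j)"
    unfolding sum_distrib_right
  proof (intro sum.cong refl)
    fix i assume "i \<in> {..j}"
    hence i: "i \<le> j" by simp
    have "((l + j) choose (j - i)) * ((l + i) choose i) = ((l + j) choose j) * (j choose (j - i))"
      using choose_mult[of "j - i" j "l + j"] i by simp
    from arg_cong[OF this, of "of_nat :: _ \<Rightarrow> 'a"]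
    show "(x gchoose i) * of_nat ((l + j) choose (j - i)) * of_nat ((l + i) choose i) =
        (x gchoose i) * of_nat (j choose (j - i)) * of_nat ((l + j) choose j)"
      by (simp add: mult_ac)
  qed
  also have "(\<Sum>i\<le>j. (x gchoose i) * of_nat (j choose (j - i))) = (x + of_nat j) gchoose j"
    by (subst gbinomial_Vandermonde_atMost[symmetric]) (simp add: binomial_gbinomial)
  finally show ?thesis .
qed

text \<open>This is \<open>gbinomial_Saalschuetz\<close> at \<open>x = -1/2\<close>, scaled by
  \<open>4 ^ j * ((2 * l) choose l)\<close>, with every half-integer binomial turned into central
  binomials.\<close>

lemma alternating_central_binomial_sum:
  "(\<Sum>k\<le>j. (-1) ^ k * of_nat (((2 * k) choose k) * (l choose k) *
      ((2 * (l + (j - k))) choose (l + (j - k))) * ((l + (j - k)) choose l))) =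
   (of_nat (((l + j) choose j) * ((2 * j) choose j) * ((2 * l) choose l)) :: 'a :: field_char_0)"
proof -
  let ?c = "\<lambda>n. of_nat ((2 * n) choose n) :: 'a"
  have "(\<Sum>k\<le>j. (-1) ^ k * of_nat (((2 * k) choose k) * (l choose k) *
      ((2 * (l + (j - k))) choose (l + (j - k))) * ((l + (j - k)) choose l))) =
    (\<Sum>k\<le>j. ?c l * 4 ^ j * (((- (1 / 2)) gchoose k) * of_nat (l choose k) *
           ((- (1 / 2) + of_nat l + of_nat (j - k)) gchoose (j - k))))"
  proof (intro sum.cong refl)
    fix k assume "k \<in> {..j}"
    \<comment> \<open>The sign of the summand, the factor \<open>(-4) ^ k\<close> from
      \<open>-1/2 gchoose k\<close> and the factor \<open>4 ^ (j - k)\<close> from the other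
      half-integer binomial combine to a constant in \<open>k\<close>.\<close>
    hence pow: "(-1) ^ k * (-4) ^ k * 4 ^ (j - k) = (4 ^ j :: 'a)"
      by (simp flip: power_mult_distrib power_add)
    have G: "- (1 / 2) + of_nat l + of_nat (j - k) = (of_nat (l + (j - k)) - 1 / 2 :: 'a)"
      by simp
    have "(-1) ^ k * of_nat (((2 * k) choose k) * (l choose k) *
        ((2 * (l + (j - k))) choose (l + (j - k))) * ((l + (j - k)) choose l)) =
      (-1) ^ k * (?c k * of_nat (l choose k) *
        of_nat (((2 * (l + (j - k))) choose (l + (j - k))) * ((l + (j - k)) choose l)))"
      by (simp add: mult_ac)
    also have "\<dots> = ((-1) ^ k * (-4) ^ k * 4 ^ (j - k)) * ?c l * (((- (1 / 2)) gchoose k) *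
        of_nat (l choose k) * ((of_nat (l + (j - k)) - 1 / 2) gchoose (j - k)))"
      unfolding central_binomial_gbinomial[symmetric]
        gbinomial_minus_half_eq_central_binomial[of k, symmetric]
      by (simp only: mult_ac)
    finally show "(-1) ^ k * of_nat (((2 * k) choose k) * (l choose k) *
      ((2 * (l + (j - k))) choose (l + (j - k))) * ((l + (j - k)) choose l)) =
      ?c l * 4 ^ j * (((- (1 / 2)) gchoose k) * of_nat (l choose k) *
           ((- (1 / 2) + of_nat l + of_nat (j - k)) gchoose (j - k)))"
      unfolding pow G by (simp only: mult_ac)
  qed
  also have "\<dots> = ?c l * 4 ^ j * (((- (1 / 2) + of_nat j) gchoose j) * of_nat ((l + j) choose j))"
    by (simp only: sum_distrib_left[symmetric] gbinomial_Saalschuetz)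
  also have "\<dots> = of_nat (((l + j) choose j) * ((2 * j) choose j) * ((2 * l) choose l))"
    using central_binomial_gbinomial[of 0 j, where 'a = 'a] by (simp add: mult_ac)
  finally show ?thesis .
qed

text \<open>One factor \<open>n choose j\<close> stays outside while the rest of the summand is
  expanded by \<open>alternating_central_binomial_sum\<close> with \<open>l = n - j\<close>. After
  swapping sums, the sum over \<open>j\<close> is \<open>(2 * (n - k)) choose n\<close>.\<close>

lemma domb_eq_alternating_sum:
  "(of_nat (domb n) :: 'a :: field_char_0) =
     (\<Sum>k\<le>n. (-1) ^ k * of_nat (((2 * k) choose k) * ((n - k) choose k) *
        ((2 * (n - k)) choose (n - k))\<^sup>2))"
proof -
  let ?c = "\<lambda>n. (2 * n) choose n"
  have "(of_nat (domb n) :: 'a) =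
      (\<Sum>j\<le>n. of_nat (n choose j) * of_nat ((n choose j) * ?c j * ?c (n - j)))"
    unfolding domb_def of_nat_sum
    by (intro sum.cong) (auto simp: power2_eq_square mult_ac diff_mult_distrib)
  also have "\<dots> = (\<Sum>j\<le>n. \<Sum>k\<le>n. (-1) ^ k * of_nat ((n choose k) * ?c k * ?c (n - k) *
      (((n - k) choose j) * ((n - k) choose (n - j)))))"
  proof (intro sum.cong refl)
    fix j assume "j \<in> {..n}"
    then obtain l where n: "n = l + j" by (auto simp: le_iff_add add.commute)
    have "of_nat (n choose j) * of_nat ((n choose j) * ?c j * ?c (n - j)) =
        of_nat (n choose j) * (\<Sum>k\<le>j. (-1) ^ k * of_nat (?c k * (l choose k) *
        ?c (l + (j - k)) * ((l + (j - k)) choose l)) :: 'a)"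
      by (subst alternating_central_binomial_sum) (simp add: n)
    also have "\<dots> = (\<Sum>k\<le>j. (-1) ^ k * of_nat ((n choose k) * ?c k * ?c (n - k) *
      (((n - k) choose j) * ((n - k) choose (n - j)))))"
      unfolding sum_distrib_left
    proof (intro sum.cong refl)
      fix k assume "k \<in> {..j}"
      hence k: "k \<le> j" by simp
      \<comment> \<open>Both sides are the multinomial coefficient of \<open>j\<close>,
        \<open>k\<close> and \<open>l - k\<close> in \<open>n\<close>; for \<open>k > l\<close> both
        vanish.\<close>
      have "(n choose j) * (l choose k) = (n choose k) * ((n - k) choose j)"
      proof (cases "k \<le> l")
        case True
        have "(n choose l) * (l choose k) = (n choose k) * ((n - k) choose (l - k))"
          by (rule choose_mult) (use True n in auto)
        thus ?thesis
          using binomial_symmetric[of l n] binomial_symmetric[of "l - k" "n - k"] True n k by simp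
      qed (use n k in \<open>simp add: binomial_eq_0\<close>)
      moreover have "l + (j - k) = n - k" "n - j = l"
        using n k by auto
      ultimately have "(n choose j) * (?c k * (l choose k) * ?c (l + (j - k)) * ((l + (j - k)) choose l)) =
        (n choose k) * ?c k * ?c (n - k) * (((n - k) choose j) * ((n - k) choose (n - j)))"
        by (simp add: mult_ac)
      from arg_cong[OF this, of "of_nat :: _ \<Rightarrow> 'a"]
      show "of_nat (n choose j) * ((-1) ^ k * of_nat (?c k * (l choose k) * ?c (l + (j - k)) *
          ((l + (j - k)) choose l))) =
        ((-1) ^ k * of_nat ((n choose k) * ?c k * ?c (n - k) *
          (((n - k) choose j) * ((n - k) choose (n - j)))) :: 'a)"
        by (simp add: mult_ac)
    qed
    \<comment> \<open>The range of \<open>k\<close> is made independent of \<open>j\<close>, ready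
      for the swap: the added terms vanish because \<open>n - k < n - j\<close>.\<close>
    also have "\<dots> = (\<Sum>k\<le>n. (-1) ^ k * of_nat ((n choose k) * ?c k * ?c (n - k) *
      (((n - k) choose j) * ((n - k) choose (n - j)))))"
    proof (rule sum.mono_neutral_left)
      show "\<forall>k\<in>{..n} - {..j}. (-1) ^ k * of_nat ((n choose k) * ?c k * ?c (n - k) *
          (((n - k) choose j) * ((n - k) choose (n - j)))) = (0 :: 'a)"
      proof
        fix k assume "k \<in> {..n} - {..j}"
        hence "(n - k) choose (n - j) = 0"
          by (intro binomial_eq_0) auto
        thus "(-1) ^ k * of_nat ((n choose k) * ?c k * ?c (n - k) *
            (((n - k) choose j) * ((n - k) choose (n - j)))) = (0 :: 'a)"
          by simp
      qed
    qed (use n in auto)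
    finally show "of_nat (n choose j) * of_nat ((n choose j) * ?c j * ?c (n - j)) = (\<dots> :: 'a)" .
  qed
  also have "\<dots> = (\<Sum>k\<le>n. (-1) ^ k * of_nat ((n choose k) * ?c k * ?c (n - k) *
      (\<Sum>j\<le>n. ((n - k) choose j) * ((n - k) choose (n - j)))))"
    by (subst sum.swap) (simp add: sum_distrib_left mult_ac)
  also have "\<dots> = (\<Sum>k\<le>n. (-1) ^ k * of_nat (?c k * ((n - k) choose k) * (?c (n - k))\<^sup>2))"
  proof (intro sum.cong refl)
    fix k assume "k \<in> {..n}"
    then obtain N where n: "n = N + k" by (auto simp: le_iff_add add.commute)
    have NN: "(n - k) + (n - k) = 2 * N"
      using n by simp
    \<comment> \<open>Both sides equal \<open>(2 * N)! / (N! * k! * (N - k)!)\<close>, as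
      \<open>n = N + k\<close>; for \<open>k > N\<close> both vanish.\<close>
    have "(n choose k) * ((2 * N) choose n) = (N choose k) * ?c N"
    proof (cases "k \<le> N")
      case True
      have "((2 * N) choose n) * (n choose N) = ((2 * N) choose N) * ((2 * N - N) choose (n - N))"
        by (rule choose_mult) (use True n in auto)
      thus ?thesis
        using binomial_symmetric[of k n] n by (simp add: mult_ac)
    qed (use n in \<open>simp add: binomial_eq_0\<close>)
    hence "(n choose k) * ?c k * ?c (n - k) * ((2 * N) choose n) =
        ?c k * ((n - k) choose k) * (?c (n - k))\<^sup>2"
      using n by (simp add: power2_eq_square mult_ac)
    thus "(-1) ^ k * of_nat ((n choose k) * ?c k * ?c (n - k) *
        (\<Sum>j\<le>n. ((n - k) choose j) * ((n - k) choose (n - j)))) =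
      ((-1) ^ k * of_nat (?c k * ((n - k) choose k) * (?c (n - k))\<^sup>2) :: 'a)"
      by (simp only: vandermonde NN)
  qed
  finally show ?thesis .
qed

text \<open>With \<open>n = k + i\<close> and \<open>(2 * i) choose i\<close> written as
  \<open>(-4) ^ i\<close> times \<open>-1/2 gchoose i\<close>, signs and powers of 4 become
  constant, and Vandermonde with upper indices \<open>-1/2\<close> and \<open>N\<close> applies. It
  evaluates the sum over \<open>n\<close> at fixed \<open>k\<close> and \<open>N = n + m\<close> in
  the triple series.\<close>

lemma binomial_transform_central_binomial:
  assumes "k \<le> N"
  shows "(\<Sum>n=k..N. (-1) ^ n * 4 ^ (N - n) *
      of_nat ((N choose n) * ((2 * k) choose k) * ((2 * (n - k)) choose (n - k)))) =
    ((-1) ^ k * of_nat (((2 * N) choose N) * (N choose k)) :: 'a :: field_char_0)"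
proof -
  let ?c = "\<lambda>n. of_nat ((2 * n) choose n) :: 'a"
  have "(\<Sum>n=k..N. (-1) ^ n * 4 ^ (N - n) *
      of_nat ((N choose n) * ((2 * k) choose k) * ((2 * (n - k)) choose (n - k)))) =
    (\<Sum>i\<le>N - k. (-1) ^ (k + i) * 4 ^ (N - k - i) *
      of_nat ((N choose (k + i)) * ((2 * k) choose k) * ((2 * i) choose i)) :: 'a)"
    by (rule sum.reindex_bij_witness[of _ "\<lambda>i. k + i" "\<lambda>n. n - k"]) (use assms in auto)
  also have "\<dots> = (\<Sum>i\<le>N - k. (-1) ^ k * ?c k * 4 ^ (N - k) *
      (((- (1 / 2)) gchoose i) * (of_nat N gchoose (N - k - i))))"
  proof (intro sum.cong refl)
    fix i assume i: "i \<in> {..N - k}"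
    hence "i + (N - (k + i)) = N - k"
      by simp
    hence pow: "(-1) ^ i * (-4) ^ i * 4 ^ (N - k - i) = (4 ^ (N - k) :: 'a)"
      by (simp flip: power_mult_distrib power_add)
    have b: "of_nat N gchoose (N - k - i) = (of_nat (N choose (k + i)) :: 'a)"
      using i assms by (simp flip: binomial_gbinomial add: binomial_symmetric[of "k + i" N])
    have "(-1) ^ (k + i) * 4 ^ (N - k - i) *
        of_nat ((N choose (k + i)) * ((2 * k) choose k) * ((2 * i) choose i)) =
      (-1) ^ k * ?c k * ((-1) ^ i * (-4) ^ i * 4 ^ (N - k - i)) *
        (((- (1 / 2)) gchoose i) * of_nat (N choose (k + i)))"
      unfolding of_nat_mult power_add gbinomial_minus_half_eq_central_binomial[of i, symmetric]
      by (simp only: mult_ac)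
    thus "(-1) ^ (k + i) * 4 ^ (N - k - i) *
        of_nat ((N choose (k + i)) * ((2 * k) choose k) * ((2 * i) choose i)) =
      (-1) ^ k * ?c k * 4 ^ (N - k) * (((- (1 / 2)) gchoose i) * (of_nat N gchoose (N - k - i)))"
      unfolding pow b .
  qed
  also have "\<dots> = (-1) ^ k * (?c k * ((of_nat (k + (N - k)) - 1 / 2) gchoose (N - k)) * 4 ^ (N - k))"
    unfolding sum_distrib_left[symmetric] gbinomial_Vandermonde_atMost
    using assms by (simp add: mult_ac)
  also have "\<dots> = (-1) ^ k * of_nat (((2 * N) choose N) * (N choose k))"
    unfolding central_binomial_gbinomial using assms by simp
  finally show ?thesis .
qed


section \<open>The binomial series and absolute convergence of the triple series\<close>

text \<open>The binomial series with exponent \<open>-(n + 1/2)\<close>. Of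
  \<open>16 ^ m = 4 ^ m * 4 ^ m\<close>, one factor is absorbed by
  \<open>central_binomial_gbinomial\<close> and the other remains.\<close>

lemma sums_central_binomial_powr:
  fixes x :: complex
  assumes "norm x < 1 / 16"
  shows "(\<lambda>m. of_nat (((2 * (n + m)) choose (n + m)) * ((n + m) choose n)) * 4 ^ m * x ^ m) sums
    (of_nat ((2 * n) choose n) / (1 - 16 * x) powr (of_nat n + 1 / 2))"
proof -
  have "norm (- 16 * x) < 1"
    using assms by (simp add: norm_mult)
  from sums_mult[OF gen_binomial_complex[OF this, of "- (of_nat n + 1 / 2)"], of "of_nat ((2 * n) choose n)"]
  have "(\<lambda>m. of_nat ((2 * n) choose n) * ((- (of_nat n + 1 / 2) gchoose m) * (- 16 * x) ^ m)) sums
    (of_nat ((2 * n) choose n) / (1 - 16 * x) powr (of_nat n + 1 / 2))"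
    unfolding powr_minus_divide by simp
  moreover have "of_nat ((2 * n) choose n) * ((- (of_nat n + 1 / 2) gchoose m) * (- 16 * x) ^ m) =
      of_nat (((2 * (n + m)) choose (n + m)) * ((n + m) choose n)) * 4 ^ m * x ^ m" for m
  proof -
    have "- (of_nat n + 1 / 2) gchoose m = (-1) ^ m * ((of_nat (n + m) - 1 / 2 :: complex) gchoose m)"
      by (subst gbinomial_minus) (simp add: algebra_simps)
    moreover have "(- 16 * x) ^ m = (-1) ^ m * 4 ^ m * 4 ^ m * x ^ m"
      by (simp flip: power_mult_distrib)
    moreover have "(-1) ^ m * (-1) ^ m = (1 :: complex)"
      by (simp flip: power_mult_distrib)
    ultimately have "of_nat ((2 * n) choose n) * ((- (of_nat n + 1 / 2) gchoose m) * (- 16 * x) ^ m) =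
      (of_nat ((2 * n) choose n) * ((of_nat (n + m) - 1 / 2) gchoose m) * 4 ^ m) * 4 ^ m * x ^ m"
      by simp
    thus ?thesis
      unfolding central_binomial_gbinomial .
  qed
  ultimately show ?thesis by simp
qed

lemma central_binomial_le: "(2 * n) choose n \<le> 4 ^ n"
  using binomial_le_pow2[of "2 * n" n] by (simp add: power_mult)

lemma summable_on_Times_nonneg:
  fixes f :: "'a \<Rightarrow> real" and g :: "'b \<Rightarrow> real"
  assumes "f summable_on A" "g summable_on B"
    and "\<And>x. x \<in> A \<Longrightarrow> f x \<ge> 0" "\<And>y. y \<in> B \<Longrightarrow> g y \<ge> 0"
  shows "(\<lambda>(x, y). f x * g y) summable_on A \<times> B"
proof (rule summable_on_SigmaI[where g = "\<lambda>x. f x * infsum g B"])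
  show "((\<lambda>y. case (x, y) of (x, y) \<Rightarrow> f x * g y) has_sum (f x * infsum g B)) B" for x
    using has_sum_cmult_right[OF has_sum_infsum[OF assms(2)]] by simp
  show "(\<lambda>x. f x * infsum g B) summable_on A"
    by (intro summable_on_cmult_left assms)
qed (use assms in auto)

lemma summable_on_geometric_triple:
  fixes a b c :: real
  assumes "0 \<le> a" "a < 1" "0 \<le> b" "b < 1" "0 \<le> c" "c < 1"
  shows "(\<lambda>((n, k), m). a ^ n * b ^ k * c ^ m) summable_on (UNIV :: ((nat \<times> nat) \<times> nat) set)"
proof -
  have geo: "(\<lambda>n. q ^ n) summable_on (UNIV :: nat set)" if "0 \<le> q" "q < 1" for q :: real
    using sums_nonneg_imp_has_sum[OF geometric_sums[of q]] that by (auto simp: summable_on_def)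
  have "(\<lambda>(p, m). (case p of (n, k) \<Rightarrow> a ^ n * b ^ k) * c ^ m) summable_on
      ((UNIV \<times> UNIV) \<times> UNIV :: ((nat \<times> nat) \<times> nat) set)"
    by (intro summable_on_Times_nonneg geo) (use assms in auto)
  thus ?thesis
    by (simp add: case_prod_unfold)
qed

text \<open>The nesting \<open>((n, k), m)\<close> lets \<open>m\<close> be summed first. The
  conditional is needed for \<open>k\<close> to range over all naturals: for \<open>k > n\<close>
  truncated subtraction would make the binomial 1 rather than 0.\<close>

definition domb_term :: "complex \<Rightarrow> (nat \<times> nat) \<times> nat \<Rightarrow> complex" where
  "domb_term x = (\<lambda>((n, k), m).
     of_nat (((2 * k) choose k)\<^sup>2 * (if k \<le> n then (2 * (n - k)) choose (n - k) else 0)) * (- x) ^ n * x ^ k *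
     (of_nat (((2 * (n + m)) choose (n + m)) * ((n + m) choose n)) * 4 ^ m * x ^ m))"

text \<open>Central binomials are bounded by powers of 4, with \<open>4 ^ (n - k)\<close> relaxed to
  \<open>4 ^ n\<close>, and \<open>(n + m) choose n\<close> by \<open>2 ^ (n + m)\<close>; hence
  \<open>32 = 4 * 4 * 2\<close> and \<open>16 = 4 * 4\<close>.\<close>

lemma norm_domb_term_le:
  "norm (domb_term x ((n, k), m)) \<le> (32 * norm x) ^ n * (16 * norm x) ^ k * (32 * norm x) ^ m"
proof -
  have "((2 * k) choose k)\<^sup>2 * (if k \<le> n then (2 * (n - k)) choose (n - k) else 0) \<le> (4 ^ k)\<^sup>2 * 4 ^ n"
    by (intro mult_mono power_mono)
       (auto intro!: central_binomial_le order.trans[OF central_binomial_le] power_increasing)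
  moreover have "((2 * (n + m)) choose (n + m)) * ((n + m) choose n) \<le> 4 ^ (n + m) * 2 ^ (n + m)"
    by (intro mult_mono central_binomial_le binomial_le_pow2) auto
  ultimately have "(((2 * k) choose k)\<^sup>2 * (if k \<le> n then (2 * (n - k)) choose (n - k) else 0)) *
      (((2 * (n + m)) choose (n + m)) * ((n + m) choose n)) * 4 ^ m \<le>
      ((4 ^ k)\<^sup>2 * 4 ^ n) * (4 ^ (n + m) * 2 ^ (n + m)) * 4 ^ m" (is "?A \<le> _")
    by (rule mult_le_mono1[OF mult_le_mono])
  also have "\<dots> = (4 * 4 * 2) ^ n * (4 * 4) ^ k * (4 * 4 * 2) ^ m"
    unfolding power_mult_distrib power_add power2_eq_square by (simp only: mult_ac)
  finally have "real ?A \<le> real (32 ^ n * 16 ^ k * 32 ^ m)"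
    unfolding of_nat_le_iff by simp
  hence "real ?A * (norm x ^ n * norm x ^ k * norm x ^ m) \<le>
      real (32 ^ n * 16 ^ k * 32 ^ m) * (norm x ^ n * norm x ^ k * norm x ^ m)"
    by (intro mult_right_mono) auto
  also have "\<dots> = (32 * norm x) ^ n * (16 * norm x) ^ k * (32 * norm x) ^ m"
    by (simp add: power_mult_distrib)
  also have "real ?A * (norm x ^ n * norm x ^ k * norm x ^ m) = norm (domb_term x ((n, k), m))"
    by (simp add: domb_term_def norm_mult norm_power)
  finally show ?thesis .
qed

lemma domb_term_summable:
  assumes "norm x < 1 / 32"
  shows "domb_term x summable_on UNIV"
proof -
  have "(\<lambda>((n, k), m). (32 * norm x) ^ n * (16 * norm x) ^ k * (32 * norm x) ^ m) summable_on
      (UNIV :: ((nat \<times> nat) \<times> nat) set)"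
    by (rule summable_on_geometric_triple) (use assms in auto)
  hence "(\<lambda>p. norm (domb_term x p)) summable_on UNIV"
    by (rule Infinite_Sum.abs_summable_on_comparison_test') (use norm_domb_term_le in auto)
  thus ?thesis
    by (rule abs_summable_summable)
qed

section \<open>Two orders of summation\<close>

lemma domb_term_has_sum_iterated:
  assumes x: "norm x < 1 / 32" and S: "(domb_term x has_sum S) UNIV"
  shows "((\<lambda>n. of_nat ((2 * n) choose n) * ((- x) ^ n / (1 - 16 * x) powr (of_nat n + 1 / 2)) *
      (\<Sum>k=0..n. of_nat (((2 * k) choose k)\<^sup>2 * ((2 * n - 2 * k) choose (n - k))) * x ^ k)) has_sum S) UNIV"
proof -
  let ?d = "\<lambda>n k. of_nat (((2 * k) choose k)\<^sup>2 * (if k \<le> n then (2 * (n - k)) choose (n - k) else 0)) :: complex"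
  let ?P = "\<lambda>n. of_nat ((2 * n) choose n) / (1 - 16 * x) powr (of_nat n + 1 / 2)"
  define g where "g = (\<lambda>(n, k). ?d n k * (- x) ^ n * x ^ k * ?P n)"
  have "(g has_sum S) (UNIV \<times> UNIV)"
  proof (rule has_sum_Sigma'[where B = "\<lambda>_. UNIV"])
    show "(domb_term x has_sum S) ((UNIV \<times> UNIV) \<times> UNIV)"
      using S by simp
    fix p :: "nat \<times> nat"
    obtain n k where p: "p = (n, k)" by force
    have "(\<lambda>m. domb_term x (p, m)) sums g p"
      unfolding p domb_term_def g_def prod.case
      by (intro sums_mult sums_central_binomial_powr) (use x in simp)
    \<comment> \<open>Absolute convergence upgrades the ordered sum over \<open>m\<close> to the
      unordered \<open>has_sum\<close> required for iterated summation.\<close>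
    moreover have "summable (\<lambda>m. norm (domb_term x (p, m)))"
    proof (rule summable_comparison_test')
      show "summable (\<lambda>m. (32 * norm x) ^ n * (16 * norm x) ^ k * (32 * norm x) ^ m)"
        by (intro summable_mult summable_geometric) (use x in simp)
    qed (use norm_domb_term_le p in simp)
    ultimately show "((\<lambda>m. domb_term x (p, m)) has_sum g p) UNIV"
      by (intro norm_summable_imp_has_sum)
  qed
  thus ?thesis
  proof (rule has_sum_Sigma')
    fix n :: nat
    have "((\<lambda>k. g (n, k)) has_sum (\<Sum>k=0..n. g (n, k))) {0..n}"
      by simp
    also have "?this \<longleftrightarrow> ((\<lambda>k. g (n, k)) has_sum (\<Sum>k=0..n. g (n, k))) UNIV"
      by (intro has_sum_cong_neutral) (auto simp: g_def)
    also have "(\<Sum>k=0..n. g (n, k)) = of_nat ((2 * n) choose n) * ((- x) ^ n / (1 - 16 * x) powr (of_nat n + 1 / 2)) *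
      (\<Sum>k=0..n. of_nat (((2 * k) choose k)\<^sup>2 * ((2 * n - 2 * k) choose (n - k))) * x ^ k)"
      unfolding g_def sum_distrib_left
      by (intro sum.cong) (auto simp: mult_ac diff_mult_distrib)
    finally show "((\<lambda>k. g (n, k)) has_sum \<dots>) UNIV" .
  qed
qed

text \<open>Grouping by the total degree \<open>M = n + k + m\<close> leaves a finite sum for each
  \<open>M\<close>. Within it \<open>k\<close> is outermost, since the sum over \<open>n\<close> at
  fixed \<open>k\<close> has a closed form.\<close>

lemma domb_term_has_sum_diagonal:
  assumes S: "(domb_term x has_sum S) UNIV"
  shows "((\<lambda>M. of_nat (domb M) * x ^ M) has_sum S) UNIV"
proof -
  let ?T = "\<lambda>M. SIGMA k:{..M}. {..M - k}"
  let ?c = "\<lambda>n. (2 * n) choose n"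
  have "((\<lambda>(M, (k, n)). domb_term x ((n, k), M - k - n)) has_sum S) (SIGMA M:UNIV. ?T M) \<longleftrightarrow>
      (domb_term x has_sum S) UNIV"
    by (rule has_sum_reindex_bij_witness[of _ "\<lambda>((n, k), m). (n + k + m, (k, n))"
          "\<lambda>(M, (k, n)). ((n, k), M - k - n)"]) auto
  with S have "((\<lambda>(M, (k, n)). domb_term x ((n, k), M - k - n)) has_sum S) (SIGMA M:UNIV. ?T M)"
    by simp
  thus ?thesis
  proof (rule has_sum_Sigma')
    fix M :: nat
    have "(\<Sum>(k, n)\<in>?T M. domb_term x ((n, k), M - k - n)) =
        (\<Sum>k\<le>M. \<Sum>n\<le>M - k. domb_term x ((n, k), M - k - n))"
      by (rule sum.Sigma[symmetric]) auto
    also have "\<dots> = (\<Sum>k\<le>M. (-1) ^ k * of_nat (?c k * ((M - k) choose k) * (?c (M - k))\<^sup>2) * x ^ M)"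
    proof (intro sum.cong refl)
      fix k assume "k \<in> {..M}"
      then obtain N where M: "M = k + N" by (auto simp: le_iff_add)
      \<comment> \<open>Terms with \<open>n < k\<close> vanish by the conditional in
        \<open>domb_term\<close>.\<close>
      have "(\<Sum>n\<le>N. domb_term x ((n, k), N - n)) = (\<Sum>n\<in>{k..N}. domb_term x ((n, k), N - n))"
        by (rule sum.mono_neutral_right) (auto simp: domb_term_def)
      also have "\<dots> = (\<Sum>n\<in>{k..N}. of_nat (?c k * ?c N) * x ^ M *
          ((-1) ^ n * 4 ^ (N - n) * of_nat ((N choose n) * ?c k * ?c (n - k))))"
      proof (intro sum.cong refl)
        fix n assume n: "n \<in> {k..N}"
        hence "x ^ M = x ^ n * x ^ k * x ^ (N - n)"
          by (simp add: M flip: power_add)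
        moreover have "(- x) ^ n = (-1) ^ n * x ^ n"
          by (simp flip: power_mult_distrib)
        moreover obtain m where "N = n + m"
          using n by (auto simp: le_iff_add)
        ultimately show "domb_term x ((n, k), N - n) = of_nat (?c k * ?c N) * x ^ M *
          ((-1) ^ n * 4 ^ (N - n) * of_nat ((N choose n) * ?c k * ?c (n - k)))"
          using n by (simp add: domb_term_def power2_eq_square mult_ac)
      qed
      also have "\<dots> = (-1) ^ k * of_nat (?c k * (N choose k) * (?c N)\<^sup>2) * x ^ M"
      \<comment> \<open>For \<open>k > N\<close> the sum is empty and \<open>N choose k\<close> is
        0.\<close>
      proof (cases "k \<le> N")
        case True
        thus ?thesis
          by (simp only: sum_distrib_left[symmetric] binomial_transform_central_binomial)
             (simp add: power2_eq_square mult_ac)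
      qed simp
      finally show "(\<Sum>n\<le>M - k. domb_term x ((n, k), M - k - n)) =
          (-1) ^ k * of_nat (?c k * ((M - k) choose k) * (?c (M - k))\<^sup>2) * x ^ M"
        by (simp add: M)
    qed
    also have "\<dots> = of_nat (domb M) * x ^ M"
      by (simp only: domb_eq_alternating_sum sum_distrib_right)
    finally have eq: "(\<Sum>(k, n)\<in>?T M. domb_term x ((n, k), M - k - n)) = of_nat (domb M) * x ^ M" .
    show "((\<lambda>p. case (M, p) of (M, (k, n)) \<Rightarrow> domb_term x ((n, k), M - k - n)) has_sum
        (of_nat (domb M) * x ^ M)) (?T M)"
      unfolding prod.case by (rule has_sum_finiteI[OF _ eq[symmetric]]) simp
  qed
qed

theorem theorem6p1:
  shows "\<forall>\<^sub>F x in nhds (0 :: complex).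
    summable (\<lambda>n. of_nat ((2 * n) choose n) * ((- x) ^ n / (1 - 16 * x) powr (of_nat n + 1 / 2)) *
      (\<Sum>k=0..n. of_nat (((2 * k) choose k)\<^sup>2 * ((2 * n - 2 * k) choose (n - k))) * x ^ k)) \<and>
    summable (\<lambda>n. of_nat (domb n) * x ^ n) \<and>
    (\<Sum>n. of_nat ((2 * n) choose n) * ((- x) ^ n / (1 - 16 * x) powr (of_nat n + 1 / 2)) *
      (\<Sum>k=0..n. of_nat (((2 * k) choose k)\<^sup>2 * ((2 * n - 2 * k) choose (n - k))) * x ^ k))
    = (\<Sum>n. of_nat (domb n) * x ^ n)"
proof -
  \<comment> \<open>The radius makes the largest ratio \<open>32 * norm x\<close> in
    \<open>norm_domb_term_le\<close> less than 1, and it lies within the radius \<open>1/16\<close>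
    of the binomial series.\<close>
  have "\<forall>\<^sub>F x in nhds (0 :: complex). x \<in> ball 0 (1 / 32)"
    by (rule eventually_nhds_in_open) auto
  hence "\<forall>\<^sub>F x in nhds (0 :: complex). norm x < 1 / 32"
    by simp
  thus ?thesis
  proof eventually_elim
    case (elim x)
    then obtain S where S: "(domb_term x has_sum S) UNIV"
      using domb_term_summable by (auto simp: summable_on_def)
    show ?case
      using has_sum_imp_sums[OF domb_term_has_sum_iterated[OF elim S]]
        has_sum_imp_sums[OF domb_term_has_sum_diagonal[OF S]]
      unfolding sums_iff by simp
  qed
qed

end
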